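(* Let $I\subset\mathbb R$ be an open interval with $0\in I$, and let $f\in C^\infty(I)$. Suppose that for every fixed $t\in I$ the function $g_t(x)=f(x+t)-f(x)$ is real-analytic on a neighborhood $I_t$ of $0$ (depending on $t$). Then $f\in C^\omega(I)$, i.e. $f$ is real-analytic on $I$. *)

theory Defs
  imports "HOL-Analysis.Analysis"
begin

text \<open>
  Both notions below are meant for open sets \<open>S\<close>: there they do not depend on the values
  of the (total) function outside \<open>S\<close>.
\<close>

definition smooth_on :: "real set \<Rightarrow> (real \<Rightarrow> real) \<Rightarrow> bool" where
  "smooth_on S f \<longleftrightarrow> (\<forall>n. \<forall>x\<in>S. (deriv ^^ n) f field_differentiable (at x))"

definition real_analytic_on :: "real set \<Rightarrow> (real \<Rightarrow> real) \<Rightarrow> bool" where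
  "real_analytic_on S f \<longleftrightarrow> (\<forall>x\<in>S. \<exists>F. (\<lambda>h. f (x + h)) has_fps_expansion F)"

end

theory Submission
  imports Defs
begin

text \<open>
  The Taylor coefficients of \<open>f\<close> at \<open>t\<close> and at \<open>0\<close> differ by those of \<open>g\<^sub>t\<close>, hence by at most
  \<open>m\<^sup>n\<^sup>+\<^sup>1\<close> for some \<open>m\<close> depending on \<open>t\<close>. By Baire's theorem one \<open>m\<close> serves for all \<open>t\<close> in some
  ball. There \<open>f\<^sup>(\<^sup>n\<^sup>)\<close> oscillates by at most \<open>2 m\<^sup>n\<^sup>+\<^sup>1 n!\<close>, and the oscillation of
  \<open>f\<^sup>(\<^sup>n\<^sup>-\<^sup>1\<^sup>)\<close> bounds \<open>f\<^sup>(\<^sup>n\<^sup>)\<close> at some point of the ball by the mean value theorem; so \<open>f\<close> is analytic at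
  some \<open>s\<close>. Then \<open>f\<close> is analytic at \<open>0\<close>, because \<open>f x = f (x + s) - g\<^sub>s x\<close>, and at every \<open>t\<close>,
  because \<open>f (x + t) = g\<^sub>t x + f x\<close>.
\<close>

lemma higher_deriv_eq_fps_nth:
  fixes f :: "'a :: {banach, real_normed_field} \<Rightarrow> 'a"
  assumes "f has_fps_expansion F"
  shows "(deriv ^^ n) f 0 = fact n * fps_nth F n"
  using assms
proof (induction n arbitrary: f F)
  case 0
  then have "eventually (\<lambda>z. eval_fps F z = f z) (nhds 0)"
    by (simp add: has_fps_expansion_def)
  then show ?case
    by (auto simp: eval_fps_at_0 dest: eventually_nhds_x_imp_x)
next
  case (Suc n)
  \<comment> \<open>Peeling off the innermost \<open>deriv\<close> matches one
    \<open>fps_deriv\<close>, whose factor \<open>n + 1\<close> completes the factorial.\<close>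
  have "(deriv ^^ Suc n) f 0 = (deriv ^^ n) (deriv f) 0"
    by (simp add: funpow_swap1)
  also have "\<dots> = fact n * fps_nth (fps_deriv F) n"
    by (intro Suc.IH has_fps_expansion_deriv Suc.prems)
  finally show ?case
    by (simp add: algebra_simps)
qed

text \<open>Convergence at some \<open>r > 0\<close> bounds the terms of the series at
  \<open>r\<close> by a constant \<open>B\<close>. A single natural number above both
  \<open>B\<close> and \<open>1 / r\<close> replaces the two, so that the bounds form a countable
  family, as Baire's theorem requires.\<close>

lemma fps_expansion_imp_higher_deriv_bound:
  fixes f :: "'a :: {banach, real_normed_field} \<Rightarrow> 'a"
  assumes "f has_fps_expansion F"
  obtains m :: nat where "\<And>n. norm ((deriv ^^ n) f 0) \<le> real m ^ Suc n * fact n"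
proof -
  have "0 < fps_conv_radius F"
    using assms by (simp add: has_fps_expansion_def)
  then obtain r where r: "0 < r" "ereal r < fps_conv_radius F"
    by (metis ereal_dense2 ereal_less(2))
  have "summable (\<lambda>n. fps_nth F n * of_real r ^ n)"
    using r by (intro summable_fps) auto
  then have "Bseq (\<lambda>n. fps_nth F n * of_real r ^ n)"
    by (intro convergent_imp_Bseq) (auto simp: convergent_def dest: summable_LIMSEQ_zero)
  then obtain B where B: "0 < B" "\<And>n. norm (fps_nth F n * of_real r ^ n) \<le> B"
    by (auto elim!: BseqE)
  obtain m :: nat where m: "max B (1 / r) \<le> real m"
    using real_arch_simple by blast
  show thesis
  proof
    fix n
    have "norm (fps_nth F n) * r ^ n \<le> B"
      using B(2)[of n] r by (simp add: norm_mult norm_power)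
    then have "norm (fps_nth F n) \<le> B * (1 / r) ^ n"
      using r by (simp add: field_simps)
    also have "\<dots> \<le> real m * real m ^ n"
      using m r B by (intro mult_mono power_mono) auto
    finally show "norm ((deriv ^^ n) f 0) \<le> real m ^ Suc n * fact n"
      using higher_deriv_eq_fps_nth[OF assms, of n]
      by (simp add: norm_mult mult.commute[of "fact n"])
  qed
qed

text \<open>By Taylor's formula with Lagrange remainder, the remainder of order \<open>n\<close> at
  \<open>h\<close> is at most \<open>A * (B * \<bar>h\<bar>) ^ n\<close>, which tends to 0 for small
  \<open>h\<close>.\<close>

lemma higher_deriv_bound_imp_fps_expansion:
  fixes f :: "real \<Rightarrow> real"
  assumes "0 < r" "0 < B"
    and diff: "\<And>n x. x \<in> ball a r \<Longrightarrow> (deriv ^^ n) f field_differentiable (at x)"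
    and bound: "\<And>n x. x \<in> ball a r \<Longrightarrow> \<bar>(deriv ^^ n) f x\<bar> \<le> A * B ^ n * fact n"
  shows "(\<lambda>h. f (a + h)) has_fps_expansion Abs_fps (\<lambda>n. (deriv ^^ n) f a / fact n)"
    (is "_ has_fps_expansion ?F")
proof -
  \<comment> \<open>The radius \<open>r\<close> keeps the intermediate point of the remainder in the
    ball, and \<open>1 / (2 * B)\<close> keeps the ratio \<open>B * \<bar>h\<bar>\<close> at most
    \<open>1 / 2\<close>.\<close>
  define s where "s = min r (1 / (2 * B))"
  have s: "0 < s" "s \<le> r" "s \<le> 1 / (2 * B)"
    using assms by (auto simp: s_def)
  have "0 \<le> A"
    using bound[of a 0] \<open>0 < r\<close> by simp
  have sums: "(\<lambda>n. fps_nth ?F n * h ^ n) sums f (a + h)" if "\<bar>h\<bar> < s" for h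
  proof -
    have remainder: "\<bar>f (a + h) - (\<Sum>m<n. fps_nth ?F m * h ^ m)\<bar> \<le> A * (1 / 2) ^ n" for n
    proof -
      have "((\<lambda>x. (deriv ^^ m) f (a + x)) has_field_derivative (deriv ^^ Suc m) f (a + x)) (at x)"
        if "\<bar>x\<bar> \<le> \<bar>h\<bar>" for m x
      proof -
        have "a + x \<in> ball a r"
          using that \<open>\<bar>h\<bar> < s\<close> s by (auto simp: dist_real_def)
        then have "((deriv ^^ m) f has_field_derivative (deriv ^^ Suc m) f (a + x)) (at (x + a))"
          using diff[of "a + x" m] by (simp add: DERIV_deriv_iff_field_differentiable add.commute)
        then show ?thesis
          by (subst (asm) DERIV_shift) (simp add: add.commute)
      qed
      then obtain x where x: "\<bar>x\<bar> \<le> \<bar>h\<bar>"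
        "f (a + h) = (\<Sum>m<n. (deriv ^^ m) f (a + 0) / fact m * h ^ m)
                       + (deriv ^^ n) f (a + x) / fact n * h ^ n"
        using Maclaurin_bi_le[of "\<lambda>m x. (deriv ^^ m) f (a + x)" "\<lambda>x. f (a + x)" n h] by auto
      have "a + x \<in> ball a r"
        using x(1) that s by (auto simp: dist_real_def)
      then have "\<bar>(deriv ^^ n) f (a + x) / fact n\<bar> \<le> A * B ^ n"
        using bound[of "a + x" n] by (simp add: field_simps)
      then have "\<bar>(deriv ^^ n) f (a + x) / fact n * h ^ n\<bar> \<le> A * B ^ n * \<bar>h\<bar> ^ n"
        unfolding abs_mult power_abs by (intro mult_right_mono) auto
      also have "\<dots> = A * (B * \<bar>h\<bar>) ^ n"
        by (simp add: power_mult_distrib)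
      also have "\<dots> \<le> A * (1 / 2) ^ n"
      proof -
        have "B * \<bar>h\<bar> \<le> B * (1 / (2 * B))"
          using that s \<open>0 < B\<close> by (intro mult_left_mono) auto
        then show ?thesis
          using \<open>0 \<le> A\<close> \<open>0 < B\<close> by (intro mult_left_mono power_mono) auto
      qed
      finally show ?thesis
        using x(2) by simp
    qed
    have "(\<lambda>n. A * (1 / 2) ^ n) \<longlonglongrightarrow> 0"
      by (intro tendsto_mult_right_zero LIMSEQ_power_zero) simp
    then have "(\<lambda>n. f (a + h) - (\<Sum>m<n. fps_nth ?F m * h ^ m)) \<longlonglongrightarrow> 0"
      by (rule Lim_null_comparison[rotated]) (use remainder in auto)
    then have "(\<lambda>n. f (a + h) - (f (a + h) - (\<Sum>m<n. fps_nth ?F m * h ^ m)))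
                 \<longlonglongrightarrow> f (a + h) - 0"
      by (intro tendsto_intros)
    then show ?thesis
      by (simp add: sums_def)
  qed
  have "ereal s \<le> fps_conv_radius ?F"
    unfolding fps_conv_radius_def
    by (rule conv_radius_geI_ex') (use sums[THEN sums_summable] in simp)
  then have "0 < fps_conv_radius ?F"
    using s by (meson ereal_less(2) less_le_trans)
  moreover have "eventually (\<lambda>h. h \<in> ball 0 s) (nhds (0 :: real))"
    using s by (intro eventually_nhds_in_open) auto
  then have "eventually (\<lambda>h. eval_fps ?F h = f (a + h)) (nhds 0)"
    by eventually_elim (use sums in \<open>auto simp: eval_fps_def dist_real_def sums_iff\<close>)
  ultimately show ?thesis
    by (simp add: has_fps_expansion_def)
qed

lemma Baire_closed_cover:
  fixes U :: "'a :: {real_normed_vector, heine_borel} set"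
  assumes "open U" "U \<noteq> {}"
    and clo: "\<And>m :: nat. closedin (top_of_set U) (A m)" and cover: "U \<subseteq> (\<Union>m. A m)"
  obtains m a r where "0 < r" "ball a r \<subseteq> A m"
proof -
  obtain x e where e: "0 < e" "cball x e \<subseteq> U"
    using assms(1,2) by (meson all_not_in_conv open_contains_cball)
  \<comment> \<open>\<open>Baire\<close> is applied in a closed set, hence in a closed ball inside
    \<open>U\<close>. If all the complements \<open>S - A m\<close> were dense in \<open>S\<close>,
    so would be their intersection, which the cover makes empty.\<close>
  define S where "S = cball x e"
  have "\<exists>m. \<not> S \<subseteq> closure (S - A m)"
  proof (rule ccontr)
    assume contra: "\<not> ?thesis"
    have "openin (top_of_set S) (S - A m)" for m
    proof -
      obtain T where "closed T" "A m = U \<inter> T"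
        using clo[of m] by (auto simp: closedin_closed)
      then have "S - A m = S \<inter> - T" "open (- T)"
        using e by (auto simp: S_def)
      then show ?thesis
        by (simp add: openin_open_Int)
    qed
    then have "S \<subseteq> closure (\<Inter>(range (\<lambda>m. S - A m)))"
      using contra by (intro Baire) (auto simp: S_def)
    moreover have "\<Inter>(range (\<lambda>m. S - A m)) = {}"
      using cover e by (auto simp: S_def)
    ultimately have "S \<subseteq> closure {}"
      by (simp only:)
    then show False
      using e by (simp add: S_def)
  qed
  then obtain m y where y: "y \<in> S" "y \<notin> closure (S - A m)"
    by blast
  \<comment> \<open>The point \<open>y\<close> may lie on the bounding sphere. Since the open ball
    is dense in \<open>S\<close>, it too has a point outside the closed set
    \<open>closure (S - A m)\<close>, hence a small ball of such points.\<close>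
  have "y \<in> closure (ball x e)"
    using y e by (simp add: S_def closure_ball)
  then have "ball x e - closure (S - A m) \<noteq> {}"
    using y(2) by (metis Diff_eq_empty_iff closed_closure closure_minimal subsetD)
  moreover have "open (ball x e - closure (S - A m))"
    by (intro open_Diff) auto
  ultimately obtain a r where "0 < r" "ball a r \<subseteq> ball x e - closure (S - A m)"
    by (meson all_not_in_conv open_contains_ball)
  moreover have "ball x e - closure (S - A m) \<subseteq> A m"
    using closure_subset[of "S - A m"] ball_subset_cball[of x e] unfolding S_def by blast
  ultimately show thesis
    using that by blast
qed

lemma higher_deriv_shift_diff:
  fixes f :: "real \<Rightarrow> real"
  assumes "open I" "smooth_on I f" "x \<in> I" "x + t \<in> I"
  shows "(deriv ^^ n) (\<lambda>x. f (x + t) - f x) x = (deriv ^^ n) f (x + t) - (deriv ^^ n) f x"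
  using assms(3,4)
proof (induction n arbitrary: x)
  case (Suc n)
  have der: "((deriv ^^ n) f has_field_derivative (deriv ^^ Suc n) f y) (at y)" if "y \<in> I" for y
    using assms(2) that by (simp add: smooth_on_def DERIV_deriv_iff_field_differentiable)
  have "((\<lambda>x. (deriv ^^ n) f (x + t) - (deriv ^^ n) f x) has_field_derivative
          (deriv ^^ Suc n) f (x + t) - (deriv ^^ Suc n) f x) (at x)"
    using der[OF Suc.prems(1)] der[OF Suc.prems(2)]
    by (intro DERIV_diff) (simp_all add: DERIV_shift)
  \<comment> \<open>The induction hypothesis holds only where both \<open>x\<close> and
    \<open>x + t\<close> lie in \<open>I\<close>. This set is open, so the identity holds near
    \<open>x\<close> and can be differentiated there.\<close>
  moreover have "open (I \<inter> (\<lambda>x. x + t) -` I)"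
    using assms(1) by (intro open_Int open_vimage) (auto intro!: continuous_intros)
  ultimately have "((deriv ^^ n) (\<lambda>x. f (x + t) - f x) has_field_derivative
          (deriv ^^ Suc n) f (x + t) - (deriv ^^ Suc n) f x) (at x)"
    by (rule has_field_derivative_transform_within_open) (use Suc in auto)
  then show ?case
    by (simp add: DERIV_imp_deriv)
qed auto

text \<open>The oscillation in order \<open>n - 1\<close> controls the derivative of order
  \<open>n\<close> at one mean value point, and the oscillation in order \<open>n\<close> carries
  this to the whole ball. The geometric rate \<open>B\<close> survives; only the constant
  grows.\<close>

lemma higher_deriv_oscillation_imp_bound:
  fixes f :: "real \<Rightarrow> real"
  assumes "0 < r" "1 \<le> B"
    and diff: "\<And>n x. x \<in> ball a r \<Longrightarrow> (deriv ^^ n) f field_differentiable (at x)"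
    and osc: "\<And>n x y. x \<in> ball a r \<Longrightarrow> y \<in> ball a r \<Longrightarrow>
                \<bar>(deriv ^^ n) f x - (deriv ^^ n) f y\<bar> \<le> A * B ^ n * fact n"
  obtains C where "\<And>n x. x \<in> ball a r \<Longrightarrow> \<bar>(deriv ^^ n) f x\<bar> \<le> C * B ^ n * fact n"
proof -
  have "0 \<le> A"
    using osc[of a a 0] assms by simp
  \<comment> \<open>The first entry serves \<open>n = 0\<close>. In the second,
    \<open>2 * A / r\<close> comes from the mean value theorem on an interval of length
    \<open>r / 2\<close>, whose endpoints lie in the open ball, and \<open>A\<close> from moving
    \<open>z\<close> to \<open>x\<close>.\<close>
  define C where "C = max (\<bar>f a\<bar> + A) (2 * A / r + A)"
  have "\<bar>(deriv ^^ n) f x\<bar> \<le> C * B ^ n * fact n" if x: "x \<in> ball a r" for n x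
  proof (cases n)
    case 0
    have "\<bar>f x\<bar> \<le> \<bar>f a\<bar> + A"
      using osc[of x a 0] x assms by simp
    then show ?thesis
      using 0 by (simp add: C_def)
  next
    case (Suc k)
    have der: "((deriv ^^ k) f has_field_derivative (deriv ^^ Suc k) f y) (at y)"
      if "a \<le> y" "y \<le> a + r / 2" for y
      using diff[of y k] that \<open>0 < r\<close>
      by (simp add: DERIV_deriv_iff_field_differentiable dist_real_def)
    obtain z where z: "a < z" "z < a + r / 2"
      "(deriv ^^ k) f (a + r / 2) - (deriv ^^ k) f a = (a + r / 2 - a) * (deriv ^^ Suc k) f z"
      using MVT2[of a "a + r / 2", OF _ der] \<open>0 < r\<close> by auto
    have "r / 2 * \<bar>(deriv ^^ n) f z\<bar> = \<bar>(deriv ^^ k) f (a + r / 2) - (deriv ^^ k) f a\<bar>"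
      unfolding z(3) Suc abs_mult using \<open>0 < r\<close> by simp
    also have "\<dots> \<le> A * B ^ k * fact k"
      using \<open>0 < r\<close> by (intro osc) (auto simp: dist_real_def)
    also have "\<dots> \<le> A * B ^ n * fact n"
      using Suc \<open>0 \<le> A\<close> \<open>1 \<le> B\<close>
      by (intro mult_mono mult_left_mono power_increasing fact_mono) auto
    finally have "\<bar>(deriv ^^ n) f z\<bar> \<le> 2 * A / r * B ^ n * fact n"
      using \<open>0 < r\<close> by (simp add: field_simps)
    moreover have "\<bar>(deriv ^^ n) f x - (deriv ^^ n) f z\<bar> \<le> A * B ^ n * fact n"
      using x z \<open>0 < r\<close> by (intro osc) (auto simp: dist_real_def)
    ultimately have "\<bar>(deriv ^^ n) f x\<bar> \<le> (2 * A / r + A) * (B ^ n * fact n)"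
      by (simp add: distrib_right mult.assoc)
    also have "\<dots> \<le> C * (B ^ n * fact n)"
      using \<open>1 \<le> B\<close> by (intro mult_right_mono) (auto simp: C_def)
    finally show ?thesis
      by (simp add: mult.assoc)
  qed
  then show thesis
    using that by blast
qed

theorem corollary1p7:
  fixes I :: "real set" and f :: "real \<Rightarrow> real"
  assumes "open I" and "is_interval I" and "0 \<in> I"
    and "smooth_on I f"
    and "\<And>t. t \<in> I \<Longrightarrow> \<exists>N. open N \<and> 0 \<in> N \<and> (\<forall>x\<in>N. x \<in> I \<and> x + t \<in> I) \<and>
           real_analytic_on N (\<lambda>x. f (x + t) - f x)"
  shows "real_analytic_on I f"
proof -
  have diff: "(deriv ^^ n) f field_differentiable (at x)" if "x \<in> I" for n x
    using assms(4) that by (simp add: smooth_on_def)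
  have expansion: "\<exists>F. (\<lambda>x. f (x + t) - f x) has_fps_expansion F" if "t \<in> I" for t
    using assms(5)[OF that] by (auto simp: real_analytic_on_def dest!: bspec[of _ _ 0])
  \<comment> \<open>All orders \<open>n\<close> are imposed at once: the set is then an intersection
    of preimages of closed half-lines, hence closed in \<open>I\<close>.\<close>
  define E where
    "E m = {t \<in> I. \<forall>n. \<bar>(deriv ^^ n) f t - (deriv ^^ n) f 0\<bar> \<le> real m ^ Suc n * fact n}" for m
  have "closedin (top_of_set I) (E m)" for m
  proof -
    have cont: "continuous_on I (\<lambda>t. \<bar>(deriv ^^ n) f t - (deriv ^^ n) f 0\<bar>)" for n
      using diff by (intro continuous_intros)
        (meson continuous_at_imp_continuous_on field_differentiable_imp_continuous_at)
    have "E m = (\<Inter>n. I \<inter> (\<lambda>t. \<bar>(deriv ^^ n) f t - (deriv ^^ n) f 0\<bar>) -` {..real m ^ Suc n * fact n})"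
      by (auto simp: E_def)
    also have "closedin (top_of_set I) \<dots>"
      by (intro closedin_INT continuous_closedin_preimage cont) auto
    finally show ?thesis .
  qed
  moreover have "I \<subseteq> (\<Union>m. E m)"
  proof
    fix t assume t: "t \<in> I"
    then obtain F where "(\<lambda>x. f (x + t) - f x) has_fps_expansion F"
      using expansion by blast
    then obtain m :: nat
      where "\<And>n. norm ((deriv ^^ n) (\<lambda>x. f (x + t) - f x) 0) \<le> real m ^ Suc n * fact n"
      using fps_expansion_imp_higher_deriv_bound by blast
    moreover have "(deriv ^^ n) (\<lambda>x. f (x + t) - f x) 0 = (deriv ^^ n) f t - (deriv ^^ n) f 0" for n
      using higher_deriv_shift_diff[OF assms(1,4,3), of t n] t by simp
    ultimately show "t \<in> (\<Union>m. E m)"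
      using t by (auto simp: E_def)
  qed
  ultimately obtain m s r where r: "0 < r" "ball s r \<subseteq> E m"
    using Baire_closed_cover[OF assms(1), of E] assms(3) by (metis empty_iff)
  then have "ball s r \<subseteq> I"
    by (auto simp: E_def)
  then have "s \<in> I"
    using \<open>0 < r\<close> by auto
  \<comment> \<open>The maximum with 1 lets powers of \<open>B\<close> increase with the exponent
    and covers \<open>m = 0\<close>.\<close>
  define B where "B = max 1 (real m)"
  \<comment> \<open>The ball need not contain 0: both values are compared with the one at 0, and the
    two errors \<open>B ^ Suc n * fact n\<close> add up, which gives the constant
    \<open>2 * B\<close>.\<close>
  have osc: "\<bar>(deriv ^^ n) f x - (deriv ^^ n) f y\<bar> \<le> (2 * B) * B ^ n * fact n"
    if "x \<in> ball s r" "y \<in> ball s r" for n x y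
  proof -
    have bound: "\<bar>(deriv ^^ n) f z - (deriv ^^ n) f 0\<bar> \<le> B ^ Suc n * fact n" if "z \<in> ball s r" for z
    proof -
      have "\<bar>(deriv ^^ n) f z - (deriv ^^ n) f 0\<bar> \<le> real m ^ Suc n * fact n"
        using r that unfolding E_def by blast
      also have "\<dots> \<le> B ^ Suc n * fact n"
        by (intro mult_right_mono power_mono) (auto simp: B_def)
      finally show ?thesis .
    qed
    show ?thesis
      using bound[OF that(1)] bound[OF that(2)] by (simp add: abs_le_iff)
  qed
  have "1 \<le> B" "0 < B"
    by (auto simp: B_def)
  have diff_ball: "(deriv ^^ n) f field_differentiable (at x)" if "x \<in> ball s r" for n x
    using diff \<open>ball s r \<subseteq> I\<close> that by blast
  obtain C where "\<And>n x. x \<in> ball s r \<Longrightarrow> \<bar>(deriv ^^ n) f x\<bar> \<le> C * B ^ n * fact n"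
    using higher_deriv_oscillation_imp_bound[OF \<open>0 < r\<close> \<open>1 \<le> B\<close> diff_ball osc] by blast
  then obtain G where "(\<lambda>h. f (s + h)) has_fps_expansion G"
    using higher_deriv_bound_imp_fps_expansion[OF \<open>0 < r\<close> \<open>0 < B\<close> diff_ball] by blast
  moreover obtain F where "(\<lambda>h. f (h + s) - f h) has_fps_expansion F"
    using expansion \<open>s \<in> I\<close> by blast
  ultimately have "(\<lambda>h. f (s + h) - (f (h + s) - f h)) has_fps_expansion G - F"
    by (rule has_fps_expansion_diff)
  then have f0: "f has_fps_expansion G - F"
    by (simp add: add.commute)
  show ?thesis
    unfolding real_analytic_on_def
  proof
    fix t assume "t \<in> I"
    then obtain H where "(\<lambda>h. f (h + t) - f h) has_fps_expansion H"
      using expansion by blast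
    then have "(\<lambda>h. (f (h + t) - f h) + f h) has_fps_expansion H + (G - F)"
      using f0 by (rule has_fps_expansion_add)
    then show "\<exists>F. (\<lambda>h. f (t + h)) has_fps_expansion F"
      by (auto simp: add.commute)
  qed
qed

end
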